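(* Consider a (single-item) auction $G$, in which bidders do not overbid, with the allocation rule of the second-price auction (the highest bidder gets the item) and a pricing rule $p$ such that, for every given bidding profile, every bidder pays at most what he would pay in a second-price auction; the social welfare is assumed to be sum-bounded. Then the robust price of anarchy of all altruistic extensions $G^\alpha$ of $G$, $\alpha\in[0,1]^N$, is at most $2$.
   Context: Auction: $N$ is the set of bidders; bidder $i$ has a valuation $v_i\in\mathbb R_+$ for the item and places a bid $b_i\in\mathbb R_+$ with $b_i\le v_i$ (no overbidding); $\Sigma$ is the set of bidding profiles $b=(b_i)_{i\in N}$. An allocation rule $a:\Sigma\to N$ determines which bidder gets the item and a pricing rule $p:\Sigma\to\mathbb R^N$ indicates how much each bidder pays. The social welfare is $\Pi(b)=v_{a(b)}$; the utility of bidder $i$ is $\Pi_i(b)=v_i-p_i(b)$ if $i=a(b)$ and $\Pi_i(b)=-p_i(b)$ otherwise. In a second-price auction, the highest bidder gets the item and pays the second-highest bid, while everybody else pays nothing. The social welfare is sum-bounded if $\Pi(b)\ge\sum_{i\in N}\Pi_i(b)$ for all $b\in\Sigma$. Altruistic extension: for $\alpha\in[0,1]^N$, $G^\alpha$ is the payoff-maximization game with the same players and strategies and utilities $\Pi_i^\alpha=(1-\alpha_i)\Pi_i+\alpha_i\Pi$; its social welfare is again $\Pi$. Smoothness: write $\Pi_{-i}:=\Pi-\Pi_i$. $G^\alpha$ is $(\lambda,\mu)$-smooth if there is an optimal profile $b^*$ (a maximizer of $\Pi$) such that for all profiles $b$, $$\sum_{i\in N}\big(\Pi_i(b_i^*,b_{-i})+\alpha_i(\Pi_{-i}(b_i^*,b_{-i})-\Pi_{-i}(b))\big)\ge\lambda\Pi(b^*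 )+\mu\Pi(b),$$ where $(b_i^*,b_{-i})$ is $b$ with bidder $i$'s bid replaced by $b_i^*$. The robust price of anarchy of $G^\alpha$ is $\inf\{\frac{1-\mu}{\lambda} : G^\alpha\text{ is }(\lambda,\mu)\text{-smooth},\ \lambda>0,\ \mu<1\}$.
   Formalization: Ties among highest bidders are assumed to be broken by a fixed priority order of the bidders, independent of the bids; if the choice among tied highest bidders may depend on losing bids, the bound 2 fails. *)

theory Defs
  imports "HOL-Library.Extended_Real"
begin

section \<open>Payoff-maximization games and their altruistic extensions\<close>

text \<open>
  The players are the elements of a finite type. A game is given by its set of strategy profiles
  \<open>S\<close>, the utilities \<open>u b i\<close> of the players, and the social welfare \<open>w b\<close>.
\<close>

definition sum_bounded ::
  "('i::finite \<Rightarrow> 's) set \<Rightarrow> (('i \<Rightarrow> 's) \<Rightarrow> 'i \<Rightarrow> real) \<Rightarrow> (('i \<Rightarrow> 's) \<Rightarrow> real) \<Rightarrow> bool"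
where
  "sum_bounded S u w \<longleftrightarrow> (\<forall>b\<in>S. w b \<ge> (\<Sum>i\<in>UNIV. u b i))"

definition altruistic_utility ::
  "('i \<Rightarrow> real) \<Rightarrow> (('i \<Rightarrow> 's) \<Rightarrow> 'i \<Rightarrow> real) \<Rightarrow> (('i \<Rightarrow> 's) \<Rightarrow> real)
    \<Rightarrow> ('i \<Rightarrow> 's) \<Rightarrow> 'i \<Rightarrow> real"
where
  "altruistic_utility \<alpha> u w b i = (1 - \<alpha> i) * u b i + \<alpha> i * w b"

definition welfare_without ::
  "(('i \<Rightarrow> 's) \<Rightarrow> 'i \<Rightarrow> real) \<Rightarrow> (('i \<Rightarrow> 's) \<Rightarrow> real) \<Rightarrow> 'i \<Rightarrow> ('i \<Rightarrow> 's) \<Rightarrow> real"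
where
  "welfare_without u w i b = w b - u b i"

text \<open>
  Smoothness of the \<open>\<alpha>\<close>-altruistic extension is expressed through the utilities \<open>u\<close> of the
  underlying game, not through \<^const>\<open>altruistic_utility\<close>; the lemma
  \<open>altruistic_smooth_summand\<close> below relates the two.
\<close>

definition altruistic_smooth ::
  "('i::finite \<Rightarrow> 's) set \<Rightarrow> (('i \<Rightarrow> 's) \<Rightarrow> 'i \<Rightarrow> real) \<Rightarrow> (('i \<Rightarrow> 's) \<Rightarrow> real)
    \<Rightarrow> ('i \<Rightarrow> real) \<Rightarrow> real \<Rightarrow> real \<Rightarrow> bool"
where
  "altruistic_smooth S u w \<alpha> l \<mu> \<longleftrightarrow>
    (\<exists>bopt. is_arg_max w (\<lambda>b. b \<in> S) bopt \<and>
      (\<forall>b\<in>S.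
        (\<Sum>i\<in>UNIV. u (b(i := bopt i)) i
          + \<alpha> i * (welfare_without u w i (b(i := bopt i)) - welfare_without u w i b))
        \<ge> l * w bopt + \<mu> * w b))"

lemma altruistic_smooth_summand:
  "u b' i + \<alpha> i * (welfare_without u w i b' - welfare_without u w i b)
    = altruistic_utility \<alpha> u w b' i - \<alpha> i * welfare_without u w i b"
  by (simp add: altruistic_utility_def welfare_without_def algebra_simps)

text \<open>
  The infimum is taken in the extended reals, so that it is \<open>\<infinity>\<close> if the extension is not
  smooth for any admissible pair of parameters.
\<close>

definition robust_price_of_anarchy ::
  "('i::finite \<Rightarrow> 's) set \<Rightarrow> (('i \<Rightarrow> 's) \<Rightarrow> 'i \<Rightarrow> real) \<Rightarrow> (('i \<Rightarrow> 's) \<Rightarrow> real)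
    \<Rightarrow> ('i \<Rightarrow> real) \<Rightarrow> ereal"
where
  "robust_price_of_anarchy S u w \<alpha> =
    Inf {ereal ((1 - \<mu>) / l) |l \<mu>. altruistic_smooth S u w \<alpha> l \<mu> \<and> l > 0 \<and> \<mu> < 1}"


section \<open>Single-item auctions\<close>

definition bidding_profiles :: "('i \<Rightarrow> real) \<Rightarrow> ('i \<Rightarrow> real) set" where
  "bidding_profiles v = {b. \<forall>i. 0 \<le> b i \<and> b i \<le> v i}"

definition auction_welfare ::
  "('i \<Rightarrow> real) \<Rightarrow> (('i \<Rightarrow> real) \<Rightarrow> 'i) \<Rightarrow> ('i \<Rightarrow> real) \<Rightarrow> real"
where
  "auction_welfare v a b = v (a b)"

definition auction_utility ::
  "('i \<Rightarrow> real) \<Rightarrow> (('i \<Rightarrow> real) \<Rightarrow> 'i) \<Rightarrow> (('i \<Rightarrow> real) \<Rightarrow> 'i \<Rightarrow> real)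
    \<Rightarrow> ('i \<Rightarrow> real) \<Rightarrow> 'i \<Rightarrow> real"
where
  "auction_utility v a p b i = (if i = a b then v i - p b i else - p b i)"

definition highest_bidders :: "('i \<Rightarrow> real) \<Rightarrow> 'i set" where
  "highest_bidders b = {i. \<forall>j. b j \<le> b i}"

text \<open>
  Ties are broken by a fixed priority order of the bidders, which may be any linear order. The
  order must not vary with the bids: if losing bids could influence how a tie between other
  bidders is resolved, then the robust price of anarchy could exceed any constant.
\<close>

definition second_price_allocation ::
  "('i \<Rightarrow> real) set \<Rightarrow> (('i \<Rightarrow> real) \<Rightarrow> 'i) \<Rightarrow> bool"
where
  "second_price_allocation S a \<longleftrightarrow>
    (\<exists>r. linear_order r \<and>
      (\<forall>b\<in>S. a b \<in> highest_bidders b \<and> (\<forall>j\<in>highest_bidders b. (a b, j) \<in> r)))"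

text \<open>
  The second-highest bid is the largest bid of the bidders other than the winner (so it equals
  the highest bid in case of a tie); it is \<open>0\<close> if there is only one bidder.
\<close>

definition second_price_payment ::
  "(('i::finite \<Rightarrow> real) \<Rightarrow> 'i) \<Rightarrow> ('i \<Rightarrow> real) \<Rightarrow> 'i \<Rightarrow> real"
where
  "second_price_payment a b i =
    (if i = a b then Max (insert 0 (b ` (UNIV - {i}))) else 0)"

end

theory Submission
  imports Defs
begin

text \<open>
  Every altruistic extension is \<open>(1, -1)\<close>-smooth. The optimal profile to use is the one in which a
  bidder \<open>k\<close> of maximal valuation bids \<open>v k\<close> and everybody else bids \<open>0\<close>. Truthful bidding does
  not work: if the winner underbids, then many other bidders of lower valuation could win by
  deviating to their valuations, and each altruistic deviator is charged for the loss of welfare.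
  The summand of a bidder \<open>i\<close> is a convex combination of his utility after the deviation and of
  the welfare after the deviation minus the welfare without \<open>i\<close> before it. For \<open>i \<noteq> k\<close> both parts
  are nonnegative; for \<open>i = k\<close> both are at least \<open>v k\<close> minus the welfare of the current profile.
\<close>

text \<open>Nonnegativity of \<open>c\<close> covers the losers, who pay \<open>0\<close>, and the
  \<open>0\<close> inserted into the maximum for the case of a single bidder.\<close>

lemma second_price_payment_le:
  fixes b :: "'i::finite \<Rightarrow> real"
  assumes "0 \<le> c" and "\<And>j. j \<noteq> i \<Longrightarrow> b j \<le> c"
  shows "second_price_payment a b i \<le> c"
  using assms by (auto simp: second_price_payment_def)

lemma second_price_allocation_highest:
  assumes "second_price_allocation S a" and "b \<in> S"
  shows "b j \<le> b (a b)"
  using assms by (auto simp: second_price_allocation_def highest_bidders_def)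

lemma fun_upd_bidding_profiles:
  assumes "b \<in> bidding_profiles v" and "0 \<le> x" and "x \<le> v i"
  shows "b(i := x) \<in> bidding_profiles v"
  using assms by (auto simp: bidding_profiles_def)

text \<open>This is where the ban on overbidding enters: it turns every bid, and hence every
  second-price payment, into a lower bound on welfare.\<close>

lemma bid_le_welfare:
  assumes "second_price_allocation (bidding_profiles v) a" and "b \<in> bidding_profiles v"
  shows "b j \<le> auction_welfare v a b"
proof -
  have "b j \<le> b (a b)"
    using assms by (rule second_price_allocation_highest)
  also have "\<dots> \<le> v (a b)"
    using assms(2) by (simp add: bidding_profiles_def)
  finally show ?thesis
    by (simp add: auction_welfare_def)
qed

text \<open>The old and the new winner are highest bidders in both profiles, so the fixed priority
  order ranks each before the other, and antisymmetry identifies them.\<close>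

lemma loser_deviates_to_zero:
  assumes alloc: "second_price_allocation (bidding_profiles v) a"
    and b: "b \<in> bidding_profiles v" and b': "b(i := 0) \<in> bidding_profiles v"
    and loses: "i \<noteq> a b"
  shows "a (b(i := 0)) = a b"
proof (cases "b i = 0")
  case True
  then show ?thesis
    by (metis fun_upd_triv)
next
  case False
  let ?b' = "b(i := 0)"
  have nonneg: "0 \<le> b j" for j
    using b by (simp add: bidding_profiles_def)
  have high: "b j \<le> b (a b)" for j
    using alloc b by (rule second_price_allocation_highest)
  have high': "?b' j \<le> ?b' (a ?b')" for j
    using alloc b' by (rule second_price_allocation_highest)
  \<comment> \<open>A positive top bid survives the deviation, so \<open>i\<close> cannot win, not
    even by a tie at \<open>0\<close>.\<close>
  have "0 < b (a b)"
    using False nonneg[of i] high[of i] by linarith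
  then have "a ?b' \<noteq> i"
    using high'[of "a b"] loses by auto
  then have "a ?b' \<in> highest_bidders b"
    using high high'[of "a b"] loses by (auto simp: highest_bidders_def intro: order_trans)
  moreover have "a b \<in> highest_bidders ?b'"
    using high nonneg loses by (auto simp: highest_bidders_def)
  moreover obtain r where "linear_order r"
    and "\<forall>b\<in>bidding_profiles v. \<forall>j\<in>highest_bidders b. (a b, j) \<in> r"
    using alloc by (auto simp: second_price_allocation_def)
  ultimately have "(a ?b', a b) \<in> r" and "(a b, a ?b') \<in> r" and "antisym r"
    using b b' by (auto simp: order_on_defs)
  then show ?thesis
    by (auto dest: antisymD)
qed

text \<open>A winner pays at most the highest rival bid, which is at most his own bid and so his
  valuation; a loser pays at most \<open>0\<close>.\<close>

lemma auction_utility_nonneg: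
  fixes v :: "'i::finite \<Rightarrow> real"
  assumes "second_price_allocation (bidding_profiles v) a" and "b \<in> bidding_profiles v"
    and "p b i \<le> second_price_payment a b i"
  shows "0 \<le> auction_utility v a p b i"
proof (cases "i = a b")
  case True
  have "0 \<le> v (a b)"
    using assms(2) by (auto simp: bidding_profiles_def intro: order_trans)
  then have "second_price_payment a b i \<le> v (a b)"
    using bid_le_welfare[OF assms(1,2)]
    by (intro second_price_payment_le) (auto simp: auction_welfare_def)
  with True assms(3) show ?thesis
    by (simp add: auction_utility_def)
next
  case False
  with assms(3) show ?thesis
    by (simp add: auction_utility_def second_price_payment_def)
qed

text \<open>If \<open>i\<close> wins, the left side is just his payment, at most the highest rival
  bid, and that bid still bounds the welfare from below once \<open>i\<close> bids \<open>0\<close>.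
  If \<open>i\<close> loses, the allocation does not change and the gap is his utility.\<close>

lemma welfare_without_le_deviation_to_zero:
  fixes v :: "'i::finite \<Rightarrow> real"
  assumes alloc: "second_price_allocation (bidding_profiles v) a"
    and b: "b \<in> bidding_profiles v" and b': "b(i := 0) \<in> bidding_profiles v"
    and pay: "p b i \<le> second_price_payment a b i"
  shows "welfare_without (auction_utility v a p) (auction_welfare v a) i b
    \<le> auction_welfare v a (b(i := 0))"
proof (cases "i = a b")
  case True
  have "b j \<le> auction_welfare v a (b(i := 0))" if "j \<noteq> i" for j
    using bid_le_welfare[OF alloc b', of j] that by simp
  moreover have "0 \<le> auction_welfare v a (b(i := 0))"
    using bid_le_welfare[OF alloc b', of i] by simp
  ultimately have "second_price_payment a b i \<le> auction_welfare v a (b(i := 0))"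
    by (intro second_price_payment_le)
  with True pay show ?thesis
    by (simp add: welfare_without_def auction_utility_def auction_welfare_def)
next
  case False
  then have "a (b(i := 0)) = a b"
    using alloc b b' by (intro loser_deviates_to_zero)
  then show ?thesis
    using auction_utility_nonneg[of v a b p i, OF alloc b pay]
    by (simp add: welfare_without_def auction_welfare_def)
qed

text \<open>If \<open>k\<close> wins, the payment is bounded by a rival bid already present in
  \<open>b\<close>. If \<open>k\<close> loses, some rival bids at least \<open>v k\<close> in
  \<open>b\<close>, so the left side is at most \<open>0\<close>.\<close>

lemma utility_of_maximal_bid:
  fixes v :: "'i::finite \<Rightarrow> real"
  assumes alloc: "second_price_allocation (bidding_profiles v) a"
    and b: "b \<in> bidding_profiles v" and b': "b(k := v k) \<in> bidding_profiles v"
    and pay: "p (b(k := v k)) k \<le> second_price_payment a (b(k := v k)) k"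
  shows "v k - auction_welfare v a b \<le> auction_utility v a p (b(k := v k)) k"
proof (cases "a (b(k := v k)) = k")
  case True
  have "0 \<le> b k"
    using b by (simp add: bidding_profiles_def)
  also have "\<dots> \<le> auction_welfare v a b"
    by (rule bid_le_welfare[OF alloc b])
  finally have "second_price_payment a (b(k := v k)) k \<le> auction_welfare v a b"
    using bid_le_welfare[OF alloc b] by (intro second_price_payment_le) auto
  with True pay show ?thesis
    by (simp add: auction_utility_def)
next
  case False
  then have "v k \<le> b (a (b(k := v k)))"
    using second_price_allocation_highest[OF alloc b', of k] by simp
  also have "\<dots> \<le> auction_welfare v a b"
    by (rule bid_le_welfare[OF alloc b])
  finally show ?thesis
    using auction_utility_nonneg[of v a "b(k := v k)" p k, OF alloc b' pay] by simp
qed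

lemma convex_combination_ge:
  fixes c :: real
  assumes "0 \<le> t" and "t \<le> 1" and "c \<le> x" and "c \<le> y"
  shows "c \<le> (1 - t) * x + t * y"
  \<comment> \<open>\<open>convex_bound_le\<close> gives upper bounds, hence the negations.\<close>
  using convex_bound_le[of "- x" "- c" "- y" "1 - t" t] assms by simp

lemma auction_altruistic_smooth:
  fixes v :: "'i::finite \<Rightarrow> real"
  assumes v_nonneg: "\<And>i. v i \<ge> 0"
    and alloc: "second_price_allocation (bidding_profiles v) a"
    and pay: "\<And>b i. b \<in> bidding_profiles v \<Longrightarrow> p b i \<le> second_price_payment a b i"
    and \<alpha>: "\<And>i. \<alpha> i \<in> {0..1}"
  shows "altruistic_smooth (bidding_profiles v) (auction_utility v a p)
           (auction_welfare v a) \<alpha> 1 (- 1)"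
proof -
  let ?S = "bidding_profiles v"
  let ?u = "auction_utility v a p"
  let ?w = "auction_welfare v a"
  obtain k where k: "v j \<le> v k" for j
    using finite_imageI[OF finite, of v UNIV] Max_in[of "range v"] Max_ge[of "range v"]
    by (metis UNIV_not_empty image_is_empty imageE rangeI)
  have w_le: "?w b \<le> v k" for b
    by (simp add: auction_welfare_def k)
  define bopt where "bopt = (\<lambda>i. if i = k then v k else 0)"
  have bopt: "bopt \<in> ?S"
    by (simp add: bopt_def bidding_profiles_def v_nonneg)
  \<comment> \<open>The winner at \<open>bopt\<close> need not be \<open>k\<close> when
    \<open>v k = 0\<close>, so the value is squeezed between the bid of \<open>k\<close> and the
    maximal valuation.\<close>
  have w_bopt: "?w bopt = v k"
    using bid_le_welfare[OF alloc bopt, of k] w_le[of bopt] by (simp add: bopt_def)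
  have "is_arg_max ?w (\<lambda>b. b \<in> ?S) bopt"
    using bopt w_bopt w_le by (auto simp: is_arg_max_linorder)
  moreover have "1 * ?w bopt + (- 1) * ?w b \<le>
      (\<Sum>i\<in>UNIV. ?u (b(i := bopt i)) i
        + \<alpha> i * (welfare_without ?u ?w i (b(i := bopt i)) - welfare_without ?u ?w i b))"
    if b: "b \<in> ?S" for b
  proof -
    let ?term = "\<lambda>i. ?u (b(i := bopt i)) i
        + \<alpha> i * (welfare_without ?u ?w i (b(i := bopt i)) - welfare_without ?u ?w i b)"
    have dev: "b(i := bopt i) \<in> ?S" for i
      using b by (intro fun_upd_bidding_profiles) (simp_all add: bopt_def v_nonneg)
    have summand: "?term i = (1 - \<alpha> i) * ?u (b(i := bopt i)) i
        + \<alpha> i * (?w (b(i := bopt i)) - welfare_without ?u ?w i b)" for i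
      by (simp add: welfare_without_def algebra_simps)
    have other: "0 \<le> ?term i" if "i \<noteq> k" for i
    proof -
      have upd: "bopt i = 0"
        using that by (simp add: bopt_def)
      have "0 \<le> ?u (b(i := bopt i)) i"
        using alloc dev pay[OF dev] by (rule auction_utility_nonneg)
      moreover have "0 \<le> ?w (b(i := bopt i)) - welfare_without ?u ?w i b"
        using welfare_without_le_deviation_to_zero[of v a b i p] alloc b dev[of i] pay[OF b]
        by (simp add: upd)
      ultimately show ?thesis
        unfolding summand using \<alpha>[of i] by (intro convex_combination_ge) auto
    qed
    have top: "v k - ?w b \<le> ?term k"
    proof -
      have upd: "bopt k = v k"
        by (simp add: bopt_def)
      have "v k - ?w b \<le> ?u (b(k := bopt k)) k"
        using utility_of_maximal_bid[of v a b k p] alloc b dev[of k] pay[OF dev[of k]] by (simp add: upd)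
      moreover have "v k \<le> ?w (b(k := bopt k))"
        using bid_le_welfare[OF alloc dev[of k], of k] by (simp add: upd)
      \<comment> \<open>The welfare without \<open>k\<close> is at most \<open>?w b\<close>, because
        the utility of \<open>k\<close> at \<open>b\<close> is nonnegative.\<close>
      then have "v k - ?w b \<le> ?w (b(k := bopt k)) - welfare_without ?u ?w k b"
        using auction_utility_nonneg[of v a b p k, OF alloc b pay[OF b]]
        by (simp add: welfare_without_def)
      ultimately show ?thesis
        unfolding summand using \<alpha>[of k] by (intro convex_combination_ge) auto
    qed
    have "v k - ?w b \<le> ?term k + (\<Sum>i\<in>UNIV - {k}. ?term i)"
      using top sum_nonneg[of "UNIV - {k}" ?term] other by simp
    also have "\<dots> = (\<Sum>i\<in>UNIV. ?term i)"
      by (simp add: sum.remove[of UNIV k ?term])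
    finally show ?thesis
      using w_bopt by simp
  qed
  ultimately show ?thesis
    unfolding altruistic_smooth_def by blast
qed

theorem theorem9:
  fixes v :: "'i::finite \<Rightarrow> real"
    and a :: "('i \<Rightarrow> real) \<Rightarrow> 'i"
    and p :: "('i \<Rightarrow> real) \<Rightarrow> 'i \<Rightarrow> real"
    and \<alpha> :: "'i \<Rightarrow> real"
  assumes "\<And>i. v i \<ge> 0"
    and "second_price_allocation (bidding_profiles v) a"
    and "\<And>b i. b \<in> bidding_profiles v \<Longrightarrow> p b i \<le> second_price_payment a b i"
    and "sum_bounded (bidding_profiles v) (auction_utility v a p) (auction_welfare v a)"
    and "\<And>i. \<alpha> i \<in> {0..1}"
  shows "robust_price_of_anarchy (bidding_profiles v) (auction_utility v a p)
           (auction_welfare v a) \<alpha> \<le> 2"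
proof -
  have "altruistic_smooth (bidding_profiles v) (auction_utility v a p)
      (auction_welfare v a) \<alpha> 1 (- 1)"
    using assms(1,2,3,5) by (rule auction_altruistic_smooth)
  then have "robust_price_of_anarchy (bidding_profiles v) (auction_utility v a p)
      (auction_welfare v a) \<alpha> \<le> ereal ((1 - (- 1)) / 1)"
    unfolding robust_price_of_anarchy_def by (intro Inf_lower) force
  then show ?thesis
    by simp
qed

end
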